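(* The following assertions hold: (a) The family of sets $\{\mathcal{S}^*(1-\alpha)\}_{\alpha\in[0,\frac12]}$ is a strict filtration of $\mathcal{G}_0$. (b) Let $f_\alpha$, $\alpha\in\left(0,\frac12\right]$, be defined by $f_\alpha(z)=\frac{z}{(1-z)^{2\alpha}}$. Then $f_\alpha\in\partial\mathcal{S}^*(1-\alpha)$. (c) The net $\{f_\alpha\}_{\alpha\in(0,\frac12]}$ is a net of totally extremal functions for this filtration, i.e. $f_\alpha$ is totally extremal for $\mathcal{S}^*(1-\alpha)$ for each $\alpha\in(0,\frac12]$. (d) For every $\alpha\in[0,\frac12]$ we have $K(\mathcal{S}^*(1-\alpha))=\frac{1}{2^{2\alpha}}$ and $B(\mathcal{S}^*(1-\alpha))=2\alpha$.
   Context: Let $\mathbb{D}$ be the open unit disk. $\mathcal{A}$ is the set of holomorphic $f:\mathbb{D}\to\mathbb{C}$ with $f(0)=0$, $f'(0)=1$; quotients $f(z)/z$ are extended by their limit at $0$. $\mathcal{G}_0=\{f\in\mathcal{A}:\operatorname{Re}(f(z)/z)>0,\ z\in\mathbb{D}\}$. For $0\le\alpha\le\frac12$, $$\mathcal{S}^*(1-\alpha)=\left\{f\in\mathcal{A}:\ \operatorname{Re}\frac{zf'(z)}{f(z)}\ge1-\alpha,\ z\in\mathbb{D}\right\}.$$ A filtration of $\mathcal{G}_0$ (indexed by a connected $J\subset\mathbb{R}$) is a family $\{\mathfrak{F}_s\}_{s\in J}$ of subsets of $\mathcal{G}_0$ with $\mathfrak{F}_s\subseteq\mathfrak{F}_t$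 for $s\le t$. It is strict if $\mathfrak{F}_s\subsetneq\mathfrak{F}_t$ for $s<t$. The boundary is $\partial\mathfrak{F}_t=\mathfrak{F}_t\setminus\bigcup_{s\in J,\,s<t}\mathfrak{F}_s$; here $\mathfrak{F}_\alpha=\mathcal{S}^*(1-\alpha)$. A function $f_*\in\mathcal{F}\subset\mathcal{A}$ is totally extremal for $\mathcal{F}$ if for all $c\in\mathbb{C}$, $r\in[0,1)$ and $f\in\mathcal{F}$: $\min_{|z|=r}\operatorname{Re}\left(c\frac{f(z)}{z}\right)\ge\min_{|z|=r}\operatorname{Re}\left(c\frac{f_*(z)}{z}\right)$. For $\mathcal{G}_1\subseteq\mathcal{G}_0$: $K(\mathcal{G}_1)=\inf_{f\in\mathcal{G}_1}\inf_{z\in\mathbb{D}}\operatorname{Re}\frac{f(z)}{z}$, $B(\mathcal{G}_1)=\frac2\pi\sup_{f\in\mathcal{G}_1}\sup_{z\in\mathbb{D}}\left|\arg\frac{f(z)}{z}\right|$ (principal argument). *)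

theory Defs
  imports "HOL-Complex_Analysis.Complex_Analysis"
begin

text \<open>Functions on the disk are total functions on the complex numbers of which only the values on
  the unit disk matter. Hence the sets below contain every total representative of each of their
  members.\<close>

abbreviation unit_disk :: "complex set" where
  "unit_disk \<equiv> ball 0 1"

text \<open>Extension of a quotient by its limit at 0 (where the library would evaluate it as 0/0 = 0).\<close>

definition ext0 :: "(complex \<Rightarrow> complex) \<Rightarrow> complex \<Rightarrow> complex" where
  "ext0 q z = (if z = 0 then Lim (at 0) q else q z)"

abbreviation quot_id :: "(complex \<Rightarrow> complex) \<Rightarrow> complex \<Rightarrow> complex" where
  "quot_id f \<equiv> ext0 (\<lambda>w. f w / w)"

definition class_A :: "(complex \<Rightarrow> complex) set" where
  "class_A = {f. f holomorphic_on unit_disk \<and> f 0 = 0 \<and> deriv f 0 = 1}"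

definition class_G0 :: "(complex \<Rightarrow> complex) set" where
  "class_G0 = {f \<in> class_A. \<forall>z\<in>unit_disk. 0 < Re (quot_id f z)}"

text \<open>The condition that \<open>f\<close> has no zero but 0 is implicit in the formation of the quotient.\<close>

definition starlike_class :: "real \<Rightarrow> (complex \<Rightarrow> complex) set" where
  "starlike_class \<beta> = {f \<in> class_A.
     (\<forall>z\<in>unit_disk - {0}. f z \<noteq> 0) \<and>
     (\<forall>z\<in>unit_disk. \<beta> \<le> Re (ext0 (\<lambda>w. w * deriv f w / f w) z))}"

definition filtration :: "real set \<Rightarrow> (real \<Rightarrow> (complex \<Rightarrow> complex) set) \<Rightarrow> bool" where
  "filtration J \<FF> \<longleftrightarrow> connected J \<and> (\<forall>t\<in>J. \<FF> t \<subseteq> class_G0) \<and>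
     (\<forall>s\<in>J. \<forall>t\<in>J. s \<le> t \<longrightarrow> \<FF> s \<subseteq> \<FF> t)"

definition strict_filtration :: "real set \<Rightarrow> (real \<Rightarrow> (complex \<Rightarrow> complex) set) \<Rightarrow> bool" where
  "strict_filtration J \<FF> \<longleftrightarrow> filtration J \<FF> \<and> (\<forall>s\<in>J. \<forall>t\<in>J. s < t \<longrightarrow> \<FF> s \<subset> \<FF> t)"

definition filtration_boundary ::
  "real set \<Rightarrow> (real \<Rightarrow> (complex \<Rightarrow> complex) set) \<Rightarrow> real \<Rightarrow> (complex \<Rightarrow> complex) set" where
  "filtration_boundary J \<FF> t = \<FF> t - (\<Union>s\<in>{s \<in> J. s < t}. \<FF> s)"

text \<open>The infima over the circle are minima: the circle is compact and the quotients are
  continuous on the disk for members of \<open>class_A\<close>.\<close>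

definition totally_extremal :: "(complex \<Rightarrow> complex) set \<Rightarrow> (complex \<Rightarrow> complex) \<Rightarrow> bool" where
  "totally_extremal F g \<longleftrightarrow> g \<in> F \<and>
     (\<forall>c. \<forall>r\<in>{0..<1}. \<forall>f\<in>F.
        (INF z\<in>sphere 0 r. Re (c * quot_id f z)) \<ge> (INF z\<in>sphere 0 r. Re (c * quot_id g z)))"

text \<open>For nonempty subsets of \<open>class_G0\<close> the real-valued infima and suprema are taken over nonempty
  bounded sets: the real parts are positive and the arguments are less than \<open>pi/2\<close> in modulus.\<close>

definition K_const :: "(complex \<Rightarrow> complex) set \<Rightarrow> real" where
  "K_const G = (INF f\<in>G. INF z\<in>unit_disk. Re (quot_id f z))"

definition B_const :: "(complex \<Rightarrow> complex) set \<Rightarrow> real" where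
  "B_const G = 2 / pi * (SUP f\<in>G. SUP z\<in>unit_disk. \<bar>Arg (quot_id f z)\<bar>)"

definition f_extremal :: "real \<Rightarrow> complex \<Rightarrow> complex" where
  "f_extremal \<alpha> z = z / (1 - z) powr complex_of_real (2 * \<alpha>)"

end

theory Submission
  imports Defs
begin

text \<open>Write \<open>f z = z * exp (g z)\<close>. Membership in the starlike class of order \<open>1 - \<alpha>\<close> says
  \<open>Re (z * g' z) \<ge> - \<alpha>\<close>. For \<open>w = 1 - exp (- g / (2 * \<alpha>))\<close>, Jack's lemma at a point where \<open>\<bar>w\<bar>\<close>
  first reaches 1 would give \<open>Re (z * g' z) \<le> - \<alpha>\<close> there, which the minimum principle forbids. Hence
  \<open>f z / z = (1 - w z) powr (- 2 * \<alpha>)\<close> with \<open>\<bar>w z\<bar> \<le> \<bar>z\<bar>\<close>. Extremality of \<open>f_extremal \<alpha>\<close> is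
  then the minimum principle for the real part of \<open>c * (1 - w) powr (- 2 * \<alpha>)\<close>, and the two constants
  are read off from the range of this kernel on the disk.\<close>

section \<open>Removable singularities and the logarithm of \<open>f z / z\<close>\<close>

text \<open>Continuity of \<open>p\<close> at 0 makes \<open>p 0\<close> the limit of
  \<open>q\<close> there. This is how every \<open>ext0\<close> term is evaluated: by a holomorphic
  function known to agree with it off 0.\<close>

lemma ext0_eqI:
  assumes p: "p holomorphic_on unit_disk" and eq: "\<And>w. w \<in> unit_disk - {0} \<Longrightarrow> q w = p w"
    and z: "z \<in> unit_disk"
  shows "ext0 q z = p z"
proof (cases "z = 0")
  case True
  have "isCont p 0"
    using holomorphic_on_imp_continuous_on[OF p] by (auto simp: continuous_on_eq_continuous_at)
  then have "(p \<longlongrightarrow> p 0) (at 0)"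
    by (simp add: isCont_def)
  then have "(q \<longlongrightarrow> p 0) (at 0)"
    by (rule Lim_transform_within_open[of _ _ _ _ unit_disk]) (use eq in auto)
  then have "Lim (at 0) q = p 0"
    by (intro tendsto_Lim) auto
  then show ?thesis
    using True by (simp add: ext0_def)
qed (use eq z in \<open>auto simp: ext0_def\<close>)

lemma class_A_quot_id:
  assumes f: "f \<in> class_A"
  shows "quot_id f holomorphic_on unit_disk" "quot_id f 0 = 1" "f z = z * quot_id f z"
proof -
  have f': "f holomorphic_on unit_disk" "f 0 = 0" "deriv f 0 = 1"
    using f by (auto simp: class_A_def)
  have holo: "(\<lambda>z. if z = 0 then deriv f 0 else f z / z) holomorphic_on unit_disk"
    by (rule pole_theorem_open_0[OF f'(1), of 0]) (use f' in auto)
  have *: "quot_id f w = (if w = 0 then deriv f 0 else f w / w)" if "w \<in> unit_disk" for w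
    by (rule ext0_eqI[OF holo]) (use that in auto)
  show "quot_id f holomorphic_on unit_disk"
    by (rule holomorphic_transform[OF holo]) (use * in auto)
  show "quot_id f 0 = 1"
    using * f' by simp
  show "f z = z * quot_id f z"
    using f' by (cases "z = 0") (auto simp: ext0_def)
qed

lemma quot_id_exp:
  assumes "g holomorphic_on unit_disk" "\<And>z. z \<in> unit_disk \<Longrightarrow> f z = z * exp (g z)" "z \<in> unit_disk"
  shows "quot_id f z = exp (g z)"
  by (rule ext0_eqI) (use assms in \<open>auto intro!: holomorphic_intros\<close>)

lemma log_representation_deriv:
  assumes g: "g holomorphic_on unit_disk" and f: "\<And>z. z \<in> unit_disk \<Longrightarrow> f z = z * exp (g z)"
    and z: "z \<in> unit_disk"
  shows "(f has_field_derivative exp (g z) * (1 + z * deriv g z)) (at z)"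
proof -
  have "(g has_field_derivative deriv g z) (at z)"
    using g z by (auto intro: holomorphic_derivI)
  then have "((\<lambda>z. z * exp (g z)) has_field_derivative exp (g z) * (1 + z * deriv g z)) (at z)"
    by (auto intro!: derivative_eq_intros simp: algebra_simps)
  then show ?thesis
    by (rule has_field_derivative_transform_within_open[of _ _ _ unit_disk]) (use z f in auto)
qed

text \<open>On the contractible disk the zero-free function \<open>quot_id f\<close> has a
  holomorphic logarithm \<open>g\<close>, and logarithmic differentiation turns
  \<open>z * deriv f z / f z\<close> into \<open>1 + z * deriv g z\<close>. The new expression is
  holomorphic at 0 as well, so neither a quotient nor \<open>ext0\<close> is left in the
  condition.\<close>

lemma starlike_class_iff:
  "f \<in> starlike_class \<beta> \<longleftrightarrow> (\<exists>g. g holomorphic_on unit_disk \<and> g 0 = 0 \<and>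
     (\<forall>z\<in>unit_disk. f z = z * exp (g z)) \<and> (\<forall>z\<in>unit_disk. \<beta> \<le> Re (1 + z * deriv g z)))"
  (is "_ \<longleftrightarrow> (\<exists>g. ?R g)")
proof -
  have ext: "ext0 (\<lambda>w. w * deriv f w / f w) z = 1 + z * deriv g z"
    if "g holomorphic_on unit_disk" "\<forall>z\<in>unit_disk. f z = z * exp (g z)" "z \<in> unit_disk" for g z
  proof (rule ext0_eqI)
    show "(\<lambda>z. 1 + z * deriv g z) holomorphic_on unit_disk"
      using that by (auto intro!: holomorphic_intros)
    fix w assume "w \<in> unit_disk - {0}"
    moreover from this have "deriv f w = exp (g w) * (1 + w * deriv g w)"
      using log_representation_deriv[of g f w] that by (auto intro: DERIV_imp_deriv)
    ultimately show "w * deriv f w / f w = 1 + w * deriv g w"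
      using that by auto
  qed (use that in auto)
  show ?thesis
  proof
    assume f: "f \<in> starlike_class \<beta>"
    then have A: "f \<in> class_A"
      by (simp add: starlike_class_def)
    have nz: "quot_id f z \<noteq> 0" if "z \<in> unit_disk" for z
      using f class_A_quot_id(2)[OF A] class_A_quot_id(3)[OF A, of z] that
      by (cases "z = 0") (auto simp: starlike_class_def)
    obtain g where g: "g holomorphic_on unit_disk" "\<And>z. z \<in> unit_disk \<Longrightarrow> quot_id f z = exp (g z)"
      by (rule contractible_imp_holomorphic_log[OF class_A_quot_id(1)[OF A]])
        (use nz in \<open>auto intro: convex_imp_contractible\<close>)
    \<comment> \<open>Since \<open>exp (g 0) = 1\<close>, subtracting \<open>g 0\<close> normalizes
      the logarithm without changing its exponential.\<close>
    define h where "h = (\<lambda>z. g z - g 0)"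
    have "exp (g 0) = 1"
      using g(2)[of 0] class_A_quot_id(2)[OF A] by simp
    then have "f z = z * exp (h z)" if "z \<in> unit_disk" for z
      using class_A_quot_id(3)[OF A, of z] g(2)[OF that] by (simp add: h_def exp_diff)
    moreover have h: "h holomorphic_on unit_disk" "h 0 = 0"
      using g(1) by (auto simp: h_def intro!: holomorphic_intros)
    ultimately have "?R h"
      using f ext[of h] by (simp add: starlike_class_def)
    then show "\<exists>g. ?R g"
      by blast
  next
    assume "\<exists>g. ?R g"
    then obtain g where g: "?R g" ..
    have D: "(f has_field_derivative exp (g z) * (1 + z * deriv g z)) (at z)" if "z \<in> unit_disk" for z
      using log_representation_deriv[of g f z] that g by auto
    have "f holomorphic_on unit_disk"
      unfolding holomorphic_on_open[OF open_ball] using D by blast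
    moreover have "deriv f 0 = 1"
      using DERIV_imp_deriv[OF D[of 0]] g by simp
    ultimately show "f \<in> starlike_class \<beta>"
      using g ext[of g] by (auto simp: starlike_class_def class_A_def)
  qed
qed

lemma starlike_class_mono: "\<beta> \<le> \<gamma> \<Longrightarrow> starlike_class \<gamma> \<subseteq> starlike_class \<beta>"
  by (force simp: starlike_class_def)

section \<open>Jack's lemma\<close>

text \<open>The real part is the inner product of \<open>f (\<gamma> s)\<close> with the velocity
  \<open>D * d\<close>. It is applied to a path along a circle and to one along a radius.\<close>

lemma has_derivative_norm_power2_compose:
  fixes \<gamma> :: "real \<Rightarrow> complex"
  assumes "(\<gamma> has_vector_derivative d) (at s)" "(f has_field_derivative D) (at (\<gamma> s))"
  shows "((\<lambda>s. (norm (f (\<gamma> s)))\<^sup>2) has_real_derivative 2 * Re (cnj (f (\<gamma> s)) * (D * d))) (at s)"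
proof -
  have "((\<lambda>s. f (\<gamma> s)) has_vector_derivative d * D) (at s)"
    using field_vector_diff_chain_at[OF assms] by (simp add: o_def)
  then have "((\<lambda>s. f (\<gamma> s) \<bullet> f (\<gamma> s)) has_derivative
      (\<lambda>h. f (\<gamma> s) \<bullet> (h *\<^sub>R (d * D)) + (h *\<^sub>R (d * D)) \<bullet> f (\<gamma> s))) (at s)"
    unfolding has_vector_derivative_def by (intro has_derivative_inner)
  moreover have "(\<lambda>h. f (\<gamma> s) \<bullet> (h *\<^sub>R (d * D)) + (h *\<^sub>R (d * D)) \<bullet> f (\<gamma> s))
      = (*) (2 * Re (cnj (f (\<gamma> s)) * (D * d)))"
    by (auto simp: fun_eq_iff inner_complex_def algebra_simps)
  ultimately show ?thesis
    by (simp add: has_field_derivative_def power2_norm_eq_inner)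
qed

text \<open>Put \<open>L = cnj (w z0) * z0 * deriv w z0\<close>. Along the circle through
  \<open>z0\<close> the modulus of \<open>w\<close> is largest at \<open>z0\<close>, so
  \<open>Im L = 0\<close>. Along the radius the Schwarz lemma makes it grow at least as fast as
  \<open>s\<close> at \<open>s = 1\<close>, so \<open>Re L \<ge> 1\<close>. As \<open>w z0\<close>
  has modulus 1, multiplying \<open>L\<close> by \<open>w z0\<close> gives the equation with
  \<open>k = Re L\<close>.\<close>

lemma Jack_lemma:
  assumes w: "w holomorphic_on unit_disk" "w 0 = 0" and z0: "z0 \<in> unit_disk"
    and less: "\<And>z. norm z < norm z0 \<Longrightarrow> norm (w z) < 1" and ge: "1 \<le> norm (w z0)"
  obtains k :: real where "1 \<le> k" "z0 * deriv w z0 = of_real k * w z0"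
proof -
  define L where "L = cnj (w z0) * (deriv w z0 * z0)"
  have nz: "z0 \<noteq> 0"
    using w ge by auto
  have D: "(w has_field_derivative deriv w z0) (at z0)"
    using w z0 by (auto intro: holomorphic_derivI)
  have le: "norm (w z) \<le> 1" if "norm z \<le> norm z0" for z
  proof -
    have c: "closure (ball 0 (norm z0)) = cball (0::complex) (norm z0)"
      using nz by (intro closure_ball) auto
    have "continuous_on (cball 0 (norm z0)) (\<lambda>z. norm (w z))"
      using w(1) z0 by (intro continuous_intros holomorphic_on_imp_continuous_on)
        (auto elim!: holomorphic_on_subset)
    then show ?thesis
      using continuous_le_on_closure[of "ball 0 (norm z0)" "\<lambda>z. norm (w z)" z 1]
        less that by (force simp: c)
  qed
  then have eq: "norm (w z0) = 1"
    using ge by (simp add: order_antisym)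
  \<comment> \<open>The path has velocity \<open>\<i> * z0\<close> at \<open>s = 0\<close>, so this
    derivative is \<open>2 * Re (\<i> * L)\<close>, that is \<open>- 2 * Im L\<close>.\<close>
  have "((\<lambda>s. (norm (w (exp (\<i> * of_real s) * z0)))\<^sup>2) has_real_derivative
      2 * Re (cnj (w (exp (\<i> * of_real 0) * z0)) * (deriv w z0 * (\<i> * z0)))) (at 0)"
    by (rule has_derivative_norm_power2_compose)
      (use D in \<open>auto intro!: derivative_eq_intros has_vector_derivative_real_field\<close>)
  moreover have "\<forall>s. \<bar>0 - s\<bar> < 1 \<longrightarrow> (norm (w (exp (\<i> * of_real s) * z0)))\<^sup>2
      \<le> (norm (w (exp (\<i> * of_real 0) * z0)))\<^sup>2"
    using le eq by (auto simp: norm_mult power_le_one)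
  ultimately have "2 * Re (cnj (w (exp (\<i> * of_real 0) * z0)) * (deriv w z0 * (\<i> * z0))) = 0"
    by (rule DERIV_local_max[OF _ zero_less_one])
  then have Im: "Im L = 0"
    by (simp add: L_def algebra_simps)
  have Schwarz: "norm (w (of_real s * z0)) \<le> s" if "0 \<le> s" "s < 1" for s
  proof -
    have "norm (w (of_real s * z0)) \<le> norm (complex_of_real s)"
    proof (rule Schwarz_Lemma(1)[of "\<lambda>z. w (z * z0)"])
      have "(\<lambda>z. z * z0) ` unit_disk \<subseteq> unit_disk"
        using z0 by (auto simp: norm_mult) (metis mult_strict_mono' norm_ge_zero mult_1)
      then show "(\<lambda>z. w (z * z0)) holomorphic_on unit_disk"
        using w(1) by (intro holomorphic_on_compose_gen[unfolded o_def, of "\<lambda>z. z * z0" _ w])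
          (auto intro!: holomorphic_intros)
      show "norm (w (z * z0)) < 1" if "norm z < 1" for z
        using that nz by (intro less) (simp add: norm_mult)
    qed (use w that in auto)
    then show ?thesis
      using that by simp
  qed
  have "((\<lambda>s. (norm (w (of_real s * z0)))\<^sup>2) has_real_derivative
      2 * Re (cnj (w (of_real 1 * z0)) * (deriv w z0 * z0))) (at 1)"
    by (rule has_derivative_norm_power2_compose)
      (use D in \<open>auto intro!: derivative_eq_intros has_vector_derivative_real_field\<close>)
  moreover have "((\<lambda>s. s\<^sup>2) has_real_derivative 2) (at (1::real))"
    by (auto intro!: derivative_eq_intros)
  ultimately have der: "((\<lambda>s. (norm (w (of_real s * z0)))\<^sup>2 - s\<^sup>2) has_real_derivative 2 * Re L - 2) (at 1)"
    unfolding L_def by (auto dest: DERIV_diff)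
  \<comment> \<open>The differentiated function vanishes at \<open>s = 1\<close> and is at most 0 to
    the left of 1; a negative derivative would make it positive there.\<close>
  have "0 \<le> 2 * Re L - 2"
  proof (rule ccontr)
    assume "\<not> 0 \<le> 2 * Re L - 2"
    then obtain d where d: "d > 0" "\<And>h. h > 0 \<Longrightarrow> h < d \<Longrightarrow>
        (norm (w (of_real 1 * z0)))\<^sup>2 - 1\<^sup>2 < (norm (w (of_real (1 - h) * z0)))\<^sup>2 - (1 - h)\<^sup>2"
      using DERIV_neg_dec_left[OF der] by auto
    define h where "h = min (d / 2) (1 / 2)"
    have "h > 0" "h < d" "h < 1"
      using d(1) by (auto simp: h_def)
    moreover have "(norm (w (of_real (1 - h) * z0)))\<^sup>2 \<le> (1 - h)\<^sup>2"
      by (rule power_mono) (use \<open>h > 0\<close> \<open>h < 1\<close> Schwarz[of "1 - h"] in auto)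
    ultimately show False
      using d(2)[of h] eq by (simp del: of_real_diff power2_le_iff_abs_le power_mono_iff)
  qed
  moreover have "z0 * deriv w z0 = of_real (Re L) * w z0"
  proof -
    have "of_real (Re L) * w z0 = L * w z0"
      using Im by (simp add: complex_eq_iff)
    also have "\<dots> = (w z0 * cnj (w z0)) * (z0 * deriv w z0)"
      by (simp add: L_def mult_ac)
    also have "w z0 * cnj (w z0) = 1"
      using eq by (simp add: complex_norm_square[symmetric])
    finally show ?thesis
      by simp
  qed
  ultimately show thesis
    using that[of "Re L"] by simp
qed

section \<open>Minimum principle and subordination to the power kernel\<close>

text \<open>The fraction on the right is the Poisson kernel, the real part of
  \<open>(1 + w) / (1 - w)\<close>. Its sign shows that \<open>w / (1 - w)\<close> has real part
  above \<open>- 1 / 2\<close> inside the unit circle and at most \<open>- 1 / 2\<close> on and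
  outside it; both sides are used.\<close>

lemma Re_divide_one_minus:
  assumes "w \<noteq> 1"
  shows "Re (w / (1 - w)) = ((1 - (norm w)\<^sup>2) / (norm (1 - w))\<^sup>2 - 1) / 2"
proof -
  define n where "n = (1 - Re w)\<^sup>2 + (Im w)\<^sup>2"
  have n: "(norm (1 - w))\<^sup>2 = n"
    by (simp add: cmod_power2 n_def)
  then have "n \<noteq> 0"
    using assms by auto
  have "Re (w / (1 - w)) = (Re w * (1 - Re w) - (Im w)\<^sup>2) / n"
    by (simp add: Re_divide n_def power2_eq_square)
  also have "Re w * (1 - Re w) - (Im w)\<^sup>2 = (1 - (norm w)\<^sup>2 - n) / 2"
    unfolding n_def cmod_power2
    by (simp add: power2_eq_square algebra_simps)
  finally show ?thesis
    using \<open>n \<noteq> 0\<close> by (simp add: n field_simps)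
qed

text \<open>The image under a nonconstant \<open>p\<close> is open, so it contains a point to the
  left of \<open>p z0\<close>.\<close>

lemma constant_on_of_Re_minimum:
  assumes p: "p holomorphic_on unit_disk" and z0: "z0 \<in> unit_disk"
    and min: "\<And>z. z \<in> unit_disk \<Longrightarrow> Re (p z0) \<le> Re (p z)"
  shows "p constant_on unit_disk"
proof (rule ccontr)
  assume "\<not> p constant_on unit_disk"
  then have "open (p ` unit_disk)"
    by (intro open_mapping_thm[OF p]) auto
  then obtain e where e: "e > 0" "cball (p z0) e \<subseteq> p ` unit_disk"
    using z0 by (meson imageI open_contains_cball)
  have "p z0 - of_real e \<in> cball (p z0) e"
    using e(1) by (simp add: dist_norm)
  with e obtain z where z: "z \<in> unit_disk" "p z = p z0 - of_real e"
    by (metis imageE subsetD)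
  show False
    using min[OF z(1)] e(1) by (simp add: z(2))
qed

text \<open>Equality would be an attained minimum, forcing \<open>p\<close> to be the constant
  \<open>p 0 = 0\<close>. The strictness is what contradicts the bound obtained from Jack's
  lemma.\<close>

lemma Re_gt_of_Re_ge:
  assumes p: "p holomorphic_on unit_disk" "p 0 = 0" and a: "0 < a"
    and ge: "\<And>z. z \<in> unit_disk \<Longrightarrow> - a \<le> Re (p z)" and z: "z \<in> unit_disk"
  shows "- a < Re (p z)"
proof (rule ccontr)
  assume "\<not> ?thesis"
  then have Re: "Re (p z) = - a"
    using ge[OF z] by simp
  then have "p constant_on unit_disk"
    using constant_on_of_Re_minimum[OF p(1) z] ge by simp
  then have "p z = p 0"
    using z unfolding constant_on_def by (metis centre_in_ball zero_less_one)
  then show False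
    using Re a p by simp
qed

text \<open>The branch of the power of \<open>1 - w\<close> with exponent
  \<open>- 2 * \<alpha>\<close> that equals 1 at 0. On the disk \<open>1 - w\<close> lies in the
  right half-plane, away from the cut of \<open>Ln\<close>.\<close>

definition power_kernel :: "real \<Rightarrow> complex \<Rightarrow> complex" where
  "power_kernel \<alpha> w = exp (- (of_real (2 * \<alpha>) * Ln (1 - w)))"

lemma Re_one_minus_pos: "w \<in> unit_disk \<Longrightarrow> 0 < Re (1 - w)"
  using complex_Re_le_cmod[of w] by simp

lemma holomorphic_Ln_one_minus: "(\<lambda>w. Ln (1 - w)) holomorphic_on unit_disk"
  using Re_one_minus_pos by (auto intro!: holomorphic_intros simp: complex_nonpos_Reals_iff) fastforce

lemma holomorphic_power_kernel: "power_kernel \<alpha> holomorphic_on unit_disk"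
  unfolding power_kernel_def[abs_def] by (intro holomorphic_intros holomorphic_Ln_one_minus)

text \<open>It reduces estimates over the whole class to estimates of one function: at a point of
  modulus \<open>r\<close>, \<open>quot_id f\<close> takes a value of the kernel on the closed disk
  of radius \<open>r\<close>.\<close>

lemma starlike_subordination:
  assumes f: "f \<in> starlike_class (1 - \<alpha>)" and \<alpha>: "0 \<le> \<alpha>"
  obtains w where "\<And>z. z \<in> unit_disk \<Longrightarrow> norm (w z) \<le> norm z"
    "\<And>z. z \<in> unit_disk \<Longrightarrow> quot_id f z = power_kernel \<alpha> (w z)"
proof -
  obtain g where g: "g holomorphic_on unit_disk" "g 0 = 0"
      "\<And>z. z \<in> unit_disk \<Longrightarrow> f z = z * exp (g z)"
      "\<And>z. z \<in> unit_disk \<Longrightarrow> 1 - \<alpha> \<le> Re (1 + z * deriv g z)"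
    using f unfolding starlike_class_iff by blast
  have q: "quot_id f z = exp (g z)" if "z \<in> unit_disk" for z
    using quot_id_exp[OF g(1,3) that] .
  have g': "(g has_field_derivative deriv g z) (at z)" if "z \<in> unit_disk" for z
    using g(1) that by (auto intro: holomorphic_derivI)
  define p where "p = (\<lambda>z. z * deriv g z)"
  have p: "p holomorphic_on unit_disk" "p 0 = 0"
    using g(1) by (auto simp: p_def intro!: holomorphic_intros)
  have ge: "- \<alpha> \<le> Re (p z)" if "z \<in> unit_disk" for z
    using g(4)[OF that] by (simp add: p_def)
  show thesis
  proof (cases "\<alpha> = 0")
    case True
    \<comment> \<open>Division by \<open>2 * \<alpha>\<close> is impossible here. Instead
      \<open>Re p\<close> attains its minimum 0 at the origin, so \<open>p\<close> and hence
      \<open>g\<close> vanish on the disk and the kernel is constantly 1. The point 0, where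
      \<open>p = 0\<close> says nothing about \<open>deriv g\<close>, is the exceptional point in
      the constancy argument below.\<close>
    then have "p constant_on unit_disk"
      using constant_on_of_Re_minimum[OF p(1), of 0] p(2) ge by simp
    then have "p z = p 0" if "z \<in> unit_disk" for z
      using that unfolding constant_on_def by (metis centre_in_ball zero_less_one)
    then have "deriv g z = 0" if "z \<in> unit_disk - {0}" for z
      using that p(2) by (auto simp: p_def)
    then have "\<forall>z\<in>unit_disk - {0}. DERIV g z :> 0"
      using g' by (metis DiffD1)
    then have "g z = 0" if "z \<in> unit_disk" for z
      using DERIV_zero_connected_constant_on[of unit_disk "{0}" g] that g(1,2)
        holomorphic_on_imp_continuous_on[OF g(1)]
      unfolding constant_on_def by (metis centre_in_ball connected_ball finite.emptyI finite_insert
          open_ball zero_less_one)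
    then show thesis
      using True by (intro that[of "\<lambda>_. 0"]) (auto simp: power_kernel_def q)
  next
    case False
    with \<alpha> have pos: "0 < \<alpha>"
      by simp
    define c where "c = complex_of_real (2 * \<alpha>)"
    have c: "c \<noteq> 0"
      using pos by (simp add: c_def)
    define w where "w = (\<lambda>z. 1 - exp (- g z / c))"
    have w: "w holomorphic_on unit_disk" "w 0 = 0"
      using g(1,2) c by (auto simp: w_def intro!: holomorphic_intros)
    have w': "(w has_field_derivative (1 - w z) * deriv g z / c) (at z)" if "z \<in> unit_disk" for z
      unfolding w_def using g'[OF that] c by (auto intro!: derivative_eq_intros)
    have less1: "norm (w z) < 1" if z: "z \<in> unit_disk" for z
    proof (rule ccontr)
      assume contra: "\<not> norm (w z) < 1"
      have sub: "cball 0 (norm z) \<subseteq> unit_disk"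
        using z by auto
      then have cont: "continuous_on (cball 0 (norm z)) w"
        using w(1) holomorphic_on_imp_continuous_on holomorphic_on_subset by blast
      \<comment> \<open>A point of least modulus in this compact set is a point where
        \<open>norm (w z)\<close> first reaches 1, as Jack's lemma demands.\<close>
      define S where "S = cball 0 (norm z) \<inter> w -` (- ball 0 1)"
      have "closed S"
        unfolding S_def by (intro continuous_closed_preimage cont) auto
      then have "compact S"
        by (metis S_def bounded_Int bounded_cball compact_eq_bounded_closed)
      moreover have "z \<in> S"
        using contra by (simp add: S_def)
      ultimately obtain z0 where z0: "z0 \<in> S" "\<And>y. y \<in> S \<Longrightarrow> norm z0 \<le> norm y"
        using continuous_attains_inf[of S norm] continuous_on_norm_id by blast
      have "norm z0 \<le> norm z"
        using z0(1) by (simp add: S_def)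
      then have z0D: "z0 \<in> unit_disk"
        using z by auto
      have "norm (w y) < 1" if "norm y < norm z0" for y
        using z0(2)[of y] that \<open>norm z0 \<le> norm z\<close> by (auto simp: S_def)
      then obtain k :: real where k: "1 \<le> k" "z0 * deriv w z0 = of_real k * w z0"
        using Jack_lemma[OF w z0D] z0(1) by (auto simp: S_def)
      have "norm (w z0) \<ge> 1"
        using z0(1) by (simp add: S_def)
      have ne: "w z0 \<noteq> 1"
        by (simp add: w_def)
      \<comment> \<open>Jack's equation is combined with
        \<open>deriv w = (1 - w) * deriv g / c\<close> and solved for \<open>p z0\<close>.\<close>
      have "of_real k * w z0 = (1 - w z0) * p z0 / c"
        using k(2) DERIV_imp_deriv[OF w'[OF z0D]] by (simp add: p_def mult_ac)
      then have "p z0 = of_real (2 * \<alpha> * k) * (w z0 / (1 - w z0))"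
        using ne c by (simp add: c_def field_simps)
      then have "Re (p z0) = 2 * \<alpha> * k * Re (w z0 / (1 - w z0))"
        by (simp only: Re_complex_of_real times_complex.sel Im_complex_of_real mult_zero_left diff_zero)
      also have "\<dots> \<le> 2 * \<alpha> * k * (- 1 / 2)"
      proof (rule mult_left_mono)
        have "(1 - (norm (w z0))\<^sup>2) / (norm (1 - w z0))\<^sup>2 \<le> 0"
          using \<open>norm (w z0) \<ge> 1\<close> by (intro divide_nonpos_nonneg) auto
        then show "Re (w z0 / (1 - w z0)) \<le> - 1 / 2"
          by (simp add: Re_divide_one_minus[OF ne])
      qed (use pos k in auto)
      also have "\<dots> \<le> - \<alpha>"
        using pos k(1) by simp
      finally show False
        using Re_gt_of_Re_ge[OF p pos ge z0D] by simp
    qed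
    show thesis
    proof (rule that)
      show "norm (w z) \<le> norm z" if "z \<in> unit_disk" for z
        using Schwarz_Lemma(1)[OF w, of z] less1 that by simp
      fix z assume z: "z \<in> unit_disk"
      \<comment> \<open>The definition of \<open>w\<close> determines \<open>- g z / c\<close> only
        up to multiples of \<open>2 * pi * \<i>\<close>. The branch is fixed by showing that
        \<open>d\<close> has derivative 0 and vanishes at 0.\<close>
      define d where "d = (\<lambda>z. Ln (1 - w z) + g z / c)"
      have d': "DERIV d y :> 0" if "y \<in> unit_disk" for y
      proof -
        have "0 < Re (1 - w y)"
          using less1[OF that] by (intro Re_one_minus_pos) simp
        then have nonpos: "1 - w y \<notin> \<real>\<^sub>\<le>\<^sub>0" "1 - w y \<noteq> 0"
          by (auto simp: complex_nonpos_Reals_iff)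
        show ?thesis
          unfolding d_def
          by (rule derivative_eq_intros refl w'[OF that] g'[OF that] nonpos c)+ (use c nonpos in simp)
      qed
      have "continuous_on unit_disk d"
        using d' by (meson DERIV_isCont continuous_at_imp_continuous_on)
      then have "d constant_on unit_disk"
        using d' by (intro DERIV_zero_connected_constant_on[of _ "{}"]) (simp_all del: mem_ball)
      then have "d z = d 0"
        using z unfolding constant_on_def by (metis centre_in_ball zero_less_one)
      then have "g z / c = - Ln (1 - w z)"
        using w(2) g(2) by (simp add: d_def eq_neg_iff_add_eq_0 add.commute)
      then have "g z = - (c * Ln (1 - w z))"
        using c by (simp add: field_simps)
      then show "quot_id f z = power_kernel \<alpha> (w z)"
        using q[OF z] by (simp add: power_kernel_def c_def)
    qed
  qed
qed

section \<open>Range of the power kernel\<close>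

text \<open>The difference \<open>h\<close> of the two sides vanishes at 0 and has derivative
  \<open>a * (tan s - tan (a * s)) \<ge> 0\<close> for \<open>s\<close> between 0 and
  \<open>\<bar>t\<bar>\<close>; evenness of the cosine covers negative \<open>t\<close>.\<close>

lemma ln_cos_mult_ge:
  assumes a: "0 \<le> a" "a \<le> 1" and t: "\<bar>t\<bar> < pi / 2"
  shows "a * ln (cos t) \<le> ln (cos (a * t))"
proof -
  define h where "h = (\<lambda>s. ln (cos (a * s)) - a * ln (cos s))"
  have "h 0 \<le> h \<bar>t\<bar>"
  proof (rule DERIV_nonneg_imp_nondecreasing[where f = h])
    fix s assume s: "0 \<le> s" "s \<le> \<bar>t\<bar>"
    have as: "0 \<le> a * s" "a * s \<le> s"
      using a s by (auto simp: mult_left_le_one_le)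
    have "cos s > 0" "cos (a * s) > 0"
      using s as t by (auto intro!: cos_gt_zero_pi)
    then have "(h has_real_derivative a * (tan s - tan (a * s))) (at s)"
      unfolding h_def by (auto intro!: derivative_eq_intros simp: tan_def field_simps)
    moreover have "tan (a * s) \<le> tan s"
      using s as t by (intro tan_mono_le) auto
    then have "0 \<le> a * (tan s - tan (a * s))"
      using a by simp
    ultimately show "\<exists>y. (h has_real_derivative y) (at s) \<and> 0 \<le> y"
      by blast
  qed simp
  then show ?thesis
    by (cases "t \<ge> 0") (auto simp: h_def)
qed

text \<open>As \<open>2 * \<alpha> \<le> 1\<close>, the imaginary part of the exponent stays in the
  range of the principal argument, so \<open>Arg\<close> recovers it.\<close>

lemma Arg_power_kernel:
  assumes "w \<in> unit_disk" "0 \<le> \<alpha>" "\<alpha> \<le> 1 / 2"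
  shows "\<bar>Arg (power_kernel \<alpha> w)\<bar> = 2 * \<alpha> * \<bar>Arg (1 - w)\<bar>" "\<bar>Arg (1 - w)\<bar> < pi / 2"
proof -
  have "0 < Re (1 - w)"
    by (rule Re_one_minus_pos) fact
  then have ne: "1 - w \<noteq> 0" and A: "\<bar>Arg (1 - w)\<bar> < pi / 2"
    using Arg_Re_pos[of "1 - w"] by auto
  then show "\<bar>Arg (1 - w)\<bar> < pi / 2"
    by simp
  have "2 * \<alpha> * \<bar>Arg (1 - w)\<bar> \<le> \<bar>Arg (1 - w)\<bar>"
    using assms by (intro mult_left_le_one_le) auto
  then have "\<bar>2 * \<alpha> * Arg (1 - w)\<bar> < pi"
    using A assms(2) by (simp add: abs_mult)
  then have "Arg (power_kernel \<alpha> w) = - (2 * \<alpha> * Arg (1 - w))"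
    unfolding power_kernel_def using ne by (subst Arg_exp) (auto simp: Arg_eq_Im_Ln)
  then show "\<bar>Arg (power_kernel \<alpha> w)\<bar> = 2 * \<alpha> * \<bar>Arg (1 - w)\<bar>"
    using assms(2) by (simp add: abs_mult)
qed

text \<open>With \<open>1 - w = r e\<^sup>i\<^sup>t\<close>, the condition \<open>\<bar>w\<bar> < 1\<close> reads \<open>r < 2 cos t\<close>.\<close>

lemma Re_power_kernel_ge:
  assumes w: "w \<in> unit_disk" and \<alpha>: "0 \<le> \<alpha>" "\<alpha> \<le> 1 / 2"
  shows "1 / 2 powr (2 * \<alpha>) \<le> Re (power_kernel \<alpha> w)"
proof -
  define r t where "r = norm (1 - w)" and "t = Arg (1 - w)"
  have pos: "0 < Re (1 - w)"
    by (rule Re_one_minus_pos) fact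
  then have ne: "1 - w \<noteq> 0" and r: "0 < r"
    by (auto simp: r_def)
  have t: "\<bar>t\<bar> < pi / 2"
    using Arg_power_kernel(2)[OF w \<alpha>] by (simp add: t_def)
  have Re: "Re (1 - w) = r * cos t"
    using ne by (simp add: r_def t_def cos_Arg[OF ne])
  have "(norm w)\<^sup>2 = 1 - 2 * Re (1 - w) + r\<^sup>2"
    unfolding r_def cmod_power2 by (simp add: power2_eq_square algebra_simps)
  moreover have "(norm w)\<^sup>2 < 1"
    using w by (simp add: power_less_one_iff abs_square_less_1)
  ultimately have "r * r < r * (2 * cos t)"
    using Re by (simp add: power2_eq_square algebra_simps)
  then have "r < 2 * cos t"
    using r by simp
  moreover have cos: "0 < cos t"
    using t by (intro cos_gt_zero_pi) auto
  \<comment> \<open>The real part of the kernel is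
    \<open>exp (- (2 * \<alpha> * ln r)) * cos (2 * \<alpha> * t)\<close>. Its lower bound is proved
    in logarithmic form, where multiplying by \<open>2 * \<alpha>\<close> leaves only the comparison
    of the two cosines.\<close>
  ultimately have "ln r \<le> ln 2 + ln (cos t)"
    using r by (simp flip: ln_mult_pos)
  then have "2 * \<alpha> * ln r \<le> 2 * \<alpha> * ln 2 + 2 * \<alpha> * ln (cos t)"
    using \<alpha>(1) mult_left_mono[of "ln r" "ln 2 + ln (cos t)" "2 * \<alpha>"] by (simp add: distrib_left)
  also have "2 * \<alpha> * ln (cos t) \<le> ln (cos (2 * \<alpha> * t))"
    using \<alpha> t by (intro ln_cos_mult_ge) auto
  finally have "- (2 * \<alpha> * ln 2) \<le> - (2 * \<alpha> * ln r) + ln (cos (2 * \<alpha> * t))"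
    by simp
  then have "exp (- (2 * \<alpha> * ln 2)) \<le> exp (- (2 * \<alpha> * ln r)) * exp (ln (cos (2 * \<alpha> * t)))"
    by (simp flip: exp_add)
  also have "exp (ln (cos (2 * \<alpha> * t))) = cos (2 * \<alpha> * t)"
  proof -
    have "\<bar>2 * \<alpha> * t\<bar> \<le> \<bar>t\<bar>"
      using \<alpha> by (simp add: abs_mult mult_left_le_one_le)
    then have "0 < cos (2 * \<alpha> * t)"
      using t by (intro cos_gt_zero_pi) auto
    then show ?thesis
      by simp
  qed
  also have "exp (- (2 * \<alpha> * ln r)) * cos (2 * \<alpha> * t) = Re (power_kernel \<alpha> w)"
    using ne by (simp add: power_kernel_def Re_exp r_def t_def Arg_eq_Im_Ln)
  finally show ?thesis
    by (simp add: powr_def exp_minus inverse_eq_divide)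
qed

section \<open>The extremal functions as members of the classes\<close>

lemma f_extremal_log_representation:
  assumes "z \<in> unit_disk"
  shows "f_extremal \<alpha> z = z * exp (- (of_real (2 * \<alpha>) * Ln (1 - z)))"
proof -
  have "1 - z \<noteq> 0"
    using assms by auto
  then show ?thesis
    by (simp add: f_extremal_def powr_def exp_minus divide_inverse)
qed

lemma quot_id_f_extremal: "z \<in> unit_disk \<Longrightarrow> quot_id (f_extremal \<alpha>) z = power_kernel \<alpha> z"
  unfolding power_kernel_def
  by (rule quot_id_exp[OF _ f_extremal_log_representation])
    (auto intro!: holomorphic_intros holomorphic_Ln_one_minus)

lemma deriv_Ln_one_minus:
  assumes "z \<in> unit_disk"
  shows "deriv (\<lambda>z. - (c * Ln (1 - z))) z = c / (1 - z)"
proof -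
  have "1 - z \<notin> \<real>\<^sub>\<le>\<^sub>0" "1 - z \<noteq> 0"
    using Re_one_minus_pos[OF assms] by (auto simp: complex_nonpos_Reals_iff)
  then have "((\<lambda>z. - (c * Ln (1 - z))) has_field_derivative c / (1 - z)) (at z)"
    by (auto intro!: derivative_eq_intros simp: field_simps)
  then show ?thesis
    by (rule DERIV_imp_deriv)
qed

text \<open>With the logarithm \<open>g\<close> below,
  \<open>z * deriv g z = 2 * \<alpha> * z / (1 - z)\<close>, and \<open>z / (1 - z)\<close> has real
  part at least \<open>- 1 / 2\<close> on the disk.\<close>

lemma f_extremal_in_starlike_class:
  assumes \<alpha>: "0 \<le> \<alpha>"
  shows "f_extremal \<alpha> \<in> starlike_class (1 - \<alpha>)"
  unfolding starlike_class_iff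
proof (intro exI conjI ballI)
  define g where "g = (\<lambda>z. - (complex_of_real (2 * \<alpha>) * Ln (1 - z)))"
  show "g holomorphic_on unit_disk"
    unfolding g_def by (intro holomorphic_intros holomorphic_Ln_one_minus)
  show "g 0 = 0"
    by (simp add: g_def)
  fix z assume z: "z \<in> unit_disk"
  show "f_extremal \<alpha> z = z * exp (g z)"
    using f_extremal_log_representation[OF z] by (simp add: g_def)
  have "z * deriv g z = of_real (2 * \<alpha>) * (z / (1 - z))"
    unfolding g_def using deriv_Ln_one_minus[OF z] by simp
  then have "Re (z * deriv g z) = 2 * \<alpha> * Re (z / (1 - z))"
    by (simp only: Re_complex_of_real times_complex.sel Im_complex_of_real mult_zero_left diff_zero)
  moreover have "- 1 / 2 \<le> Re (z / (1 - z))"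
  proof -
    have "z \<noteq> 1" "(norm z)\<^sup>2 \<le> 1"
      using z by (auto simp: power_le_one)
    then show ?thesis
      by (simp add: Re_divide_one_minus)
  qed
  then have "2 * \<alpha> * (- 1 / 2) \<le> 2 * \<alpha> * Re (z / (1 - z))"
    using \<alpha> by (intro mult_left_mono) auto
  ultimately show "1 - \<alpha> \<le> Re (1 + z * deriv g z)"
    by simp
qed

text \<open>As \<open>z\<close> tends to -1 along the real axis, \<open>z * deriv h z\<close> tends
  to \<open>- t\<close>, so it falls below \<open>- s\<close>. Both strictness and the boundary
  claim rest on this.\<close>

lemma f_extremal_notin_starlike_class:
  assumes st: "0 \<le> s" "s < t"
  shows "f_extremal t \<notin> starlike_class (1 - s)"
proof
  assume "f_extremal t \<in> starlike_class (1 - s)"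
  then obtain g where g: "g holomorphic_on unit_disk" "g 0 = 0"
      "\<And>z. z \<in> unit_disk \<Longrightarrow> f_extremal t z = z * exp (g z)"
      "\<And>z. z \<in> unit_disk \<Longrightarrow> 1 - s \<le> Re (1 + z * deriv g z)"
    unfolding starlike_class_iff by blast
  define h where "h = (\<lambda>z. - (complex_of_real (2 * t) * Ln (1 - z)))"
  \<comment> \<open>The solution of \<open>2 * t * x / (1 + x) = (s + t) / 2\<close>, the midpoint
    between \<open>s\<close> and \<open>t\<close>.\<close>
  define x where "x = (s + t) / (3 * t - s)"
  have x: "0 < x" "x < 1"
    using st by (auto simp: x_def field_simps)
  have xD: "complex_of_real (- x) \<in> unit_disk"
    using x by simp
  have holo: "h holomorphic_on unit_disk"
    unfolding h_def by (intro holomorphic_intros holomorphic_Ln_one_minus)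
  \<comment> \<open>The logarithm \<open>g\<close> is not shown to equal \<open>h\<close>. Both
    express the same derivative, so \<open>1 + z * deriv u z\<close> agrees for the two wherever
    their exponentials do.\<close>
  have D: "exp (u z) * (1 + z * deriv u z) = deriv (f_extremal t) z"
    if "u = g \<or> u = h" "z \<in> unit_disk" for u z
  proof -
    have "(f_extremal t has_field_derivative exp (u z) * (1 + z * deriv u z)) (at z)"
      using that g(1,3) holo f_extremal_log_representation[of _ t]
      by (intro log_representation_deriv) (auto simp: h_def)
    then show ?thesis
      by (simp add: DERIV_imp_deriv)
  qed
  have "exp (g (of_real (- x))) = exp (h (of_real (- x)))"
    using g(3)[OF xD] f_extremal_log_representation[OF xD, of t] x by (simp add: h_def)
  then have "1 + of_real (- x) * deriv g (of_real (- x)) = 1 + of_real (- x) * deriv h (of_real (- x))"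
    using D[of g "of_real (- x)"] D[of h "of_real (- x)"] xD by (metis exp_not_eq_zero mult_left_cancel)
  also have "\<dots> = of_real (1 - x * (2 * t) / (1 + x))"
    using deriv_Ln_one_minus[OF xD, of "of_real (2 * t)"] by (simp add: h_def)
  finally have "1 - s \<le> 1 - x * (2 * t) / (1 + x)"
    using g(4)[OF xD] by (metis Re_complex_of_real)
  moreover have "x * (2 * t) / (1 + x) = (s + t) / 2"
    using st by (simp add: x_def field_simps)
  ultimately show False
    using st by simp
qed

section \<open>Bounds over the class, strict filtration and boundary\<close>

lemma starlike_class_Re_ge:
  assumes f: "f \<in> starlike_class (1 - \<alpha>)" and \<alpha>: "0 \<le> \<alpha>" "\<alpha> \<le> 1 / 2" and z: "z \<in> unit_disk"
  shows "1 / 2 powr (2 * \<alpha>) \<le> Re (quot_id f z)"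
proof -
  obtain w where "\<And>z. z \<in> unit_disk \<Longrightarrow> norm (w z) \<le> norm z"
    "\<And>z. z \<in> unit_disk \<Longrightarrow> quot_id f z = power_kernel \<alpha> (w z)"
    using starlike_subordination[OF f \<alpha>(1)] by metis
  moreover from this(1)[OF z] have "w z \<in> unit_disk"
    using z by simp
  ultimately show ?thesis
    using Re_power_kernel_ge[OF _ \<alpha>] z by simp
qed

lemma starlike_class_Arg_le:
  assumes f: "f \<in> starlike_class (1 - \<alpha>)" and \<alpha>: "0 \<le> \<alpha>" "\<alpha> \<le> 1 / 2" and z: "z \<in> unit_disk"
  shows "\<bar>Arg (quot_id f z)\<bar> \<le> \<alpha> * pi"
proof -
  obtain w where w: "\<And>z. z \<in> unit_disk \<Longrightarrow> norm (w z) \<le> norm z"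
    "\<And>z. z \<in> unit_disk \<Longrightarrow> quot_id f z = power_kernel \<alpha> (w z)"
    using starlike_subordination[OF f \<alpha>(1)] by metis
  have "w z \<in> unit_disk"
    using z w(1)[OF z] by simp
  then show ?thesis
    using Arg_power_kernel[of "w z" \<alpha>] \<alpha> w(2)[OF z] mult_left_mono[of "\<bar>Arg (1 - w z)\<bar>" "pi / 2" "2 * \<alpha>"]
    by (simp add: algebra_simps)
qed

lemma strict_filtration_starlike_class:
  "strict_filtration {0..1/2} (\<lambda>\<alpha>. starlike_class (1 - \<alpha>))"
  unfolding strict_filtration_def filtration_def
proof (intro conjI ballI impI)
  fix t :: real assume t: "t \<in> {0..1/2}"
  show "starlike_class (1 - t) \<subseteq> class_G0"
  proof
    fix f assume f: "f \<in> starlike_class (1 - t)"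
    have "0 < Re (quot_id f z)" if "z \<in> unit_disk" for z
      using starlike_class_Re_ge[OF f _ _ that] t
      by (smt (verit) atLeastAtMost_iff powr_gt_zero zero_less_divide_iff)
    then show "f \<in> class_G0"
      using f by (simp add: class_G0_def starlike_class_def)
  qed
next
  fix s t :: real assume st: "s \<in> {0..1/2}" "t \<in> {0..1/2}" "s < t"
  then have "f_extremal t \<in> starlike_class (1 - t)" "f_extremal t \<notin> starlike_class (1 - s)"
    using f_extremal_in_starlike_class[of t] f_extremal_notin_starlike_class[of s t] by auto
  then show "starlike_class (1 - s) \<subset> starlike_class (1 - t)"
    using starlike_class_mono[of "1 - t" "1 - s"] st by auto
qed (auto intro: subsetD[OF starlike_class_mono, rotated])

lemma f_extremal_boundary:
  assumes "\<alpha> \<in> {0<..1/2}"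
  shows "f_extremal \<alpha> \<in> filtration_boundary {0..1/2} (\<lambda>\<alpha>. starlike_class (1 - \<alpha>)) \<alpha>"
  using assms f_extremal_notin_starlike_class f_extremal_in_starlike_class[of \<alpha>]
  by (auto simp: filtration_boundary_def)

section \<open>Total extremality\<close>

lemma totally_extremal_f_extremal:
  assumes \<alpha>: "0 \<le> \<alpha>"
  shows "totally_extremal (starlike_class (1 - \<alpha>)) (f_extremal \<alpha>)"
  unfolding totally_extremal_def
proof (intro conjI allI ballI)
  show "f_extremal \<alpha> \<in> starlike_class (1 - \<alpha>)"
    by (rule f_extremal_in_starlike_class) fact
  fix c :: complex and r :: real and f
  assume r: "r \<in> {0..<1}" and f: "f \<in> starlike_class (1 - \<alpha>)"
  obtain w where w: "\<And>z. z \<in> unit_disk \<Longrightarrow> norm (w z) \<le> norm z"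
    "\<And>z. z \<in> unit_disk \<Longrightarrow> quot_id f z = power_kernel \<alpha> (w z)"
    using starlike_subordination[OF f \<alpha>] by metis
  have sub: "sphere 0 r \<subseteq> unit_disk" "cball 0 r \<subseteq> unit_disk"
    using r by auto
  have holo: "(\<lambda>z. - (c * power_kernel \<alpha> z)) holomorphic_on unit_disk"
    by (intro holomorphic_intros holomorphic_power_kernel)
  define m where "m = (INF z\<in>sphere 0 r. Re (c * power_kernel \<alpha> z))"
  have "continuous_on (sphere 0 r) (\<lambda>z. Re (c * power_kernel \<alpha> z))"
    using holomorphic_on_imp_continuous_on[OF holomorphic_power_kernel] sub(1)
    by (intro continuous_intros) (auto intro: continuous_on_subset)
  then have "compact ((\<lambda>z. Re (c * power_kernel \<alpha> z)) ` sphere 0 r)"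
    by (rule compact_continuous_image) simp
  then have "bdd_below ((\<lambda>z. Re (c * power_kernel \<alpha> z)) ` sphere 0 r)"
    by (simp add: bounded_imp_bdd_below compact_imp_bounded)
  then have m_le: "m \<le> Re (c * power_kernel \<alpha> z)" if "z \<in> sphere 0 r" for z
    unfolding m_def using that by (rule cINF_lower)
  \<comment> \<open>The point \<open>w z\<close> may lie inside the circle, so the bound is extended
    to the closed disk, by the maximum principle for the negated function. For \<open>r = 0\<close>
    circle and closed disk are both the single point 0.\<close>
  have m_le': "m \<le> Re (c * power_kernel \<alpha> z)" if "z \<in> cball 0 r" for z
  proof -
    have "Re (- (c * power_kernel \<alpha> z)) \<le> - m"
    proof (rule maximum_real_frontier[of "\<lambda>z. - (c * power_kernel \<alpha> z)" "cball 0 r"])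
      show "(\<lambda>z. - (c * power_kernel \<alpha> z)) holomorphic_on interior (cball 0 r)"
        using holo sub(2) by (meson holomorphic_on_subset interior_subset order_trans)
      show "continuous_on (closure (cball 0 r)) (\<lambda>z. - (c * power_kernel \<alpha> z))"
        using holo sub(2) by (simp add: closure_closed holomorphic_on_imp_continuous_on holomorphic_on_subset)
      show "Re (- (c * power_kernel \<alpha> z)) \<le> - m" if "z \<in> frontier (cball 0 r)" for z
        using m_le[of z] that by simp
    qed (use that in auto)
    then show ?thesis
      by simp
  qed
  have "(INF z\<in>sphere 0 r. Re (c * quot_id (f_extremal \<alpha>) z)) = m"
    unfolding m_def by (rule INF_cong) (use sub(1) quot_id_f_extremal in auto)
  also have "m \<le> (INF z\<in>sphere 0 r. Re (c * quot_id f z))"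
  proof (rule cINF_greatest)
    show "sphere (0::complex) r \<noteq> {}"
      using r by simp
    fix z :: complex assume z: "z \<in> sphere 0 r"
    then have zD: "z \<in> unit_disk"
      using sub by blast
    have "w z \<in> cball 0 r"
      using w(1)[OF zD] z by simp
    then show "m \<le> Re (c * quot_id f z)"
      using m_le'[of "w z"] w(2)[OF zD] by simp
  qed
  finally show "(INF z\<in>sphere 0 r. Re (c * quot_id (f_extremal \<alpha>) z)) \<le> (INF z\<in>sphere 0 r. Re (c * quot_id f z))" .
qed

section \<open>The constants K and B\<close>

lemma power_kernel_of_real:
  assumes "x < 1"
  shows "power_kernel \<alpha> (of_real x) = of_real ((1 - x) powr (- 2 * \<alpha>))"
proof -
  have "Ln (1 - of_real x) = of_real (ln (1 - x))"
    using assms Ln_of_real[of "1 - x"] by simp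
  then have "power_kernel \<alpha> (of_real x) = exp (of_real (- 2 * \<alpha> * ln (1 - x)))"
    by (simp add: power_kernel_def)
  then show ?thesis
    using assms by (simp only: exp_of_real) (simp add: powr_def)
qed

text \<open>The lower bound for the class is approached by \<open>f_extremal \<alpha>\<close> at
  \<open>- x\<close> as \<open>x\<close> tends to 1 from the left; the point -1 itself is outside
  the disk.\<close>

lemma K_const_starlike_class:
  assumes \<alpha>: "0 \<le> \<alpha>" "\<alpha> \<le> 1 / 2"
  shows "K_const (starlike_class (1 - \<alpha>)) = 1 / 2 powr (2 * \<alpha>)"
proof (rule antisym)
  let ?F = "starlike_class (1 - \<alpha>)" and ?m = "1 / 2 powr (2 * \<alpha>)"
  have inner: "?m \<le> (INF z\<in>unit_disk. Re (quot_id f z))" if "f \<in> ?F" for f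
    by (rule cINF_greatest) (use starlike_class_Re_ge[OF that \<alpha>] in auto)
  show "?m \<le> K_const ?F"
    unfolding K_const_def
    by (rule cINF_greatest) (use inner f_extremal_in_starlike_class[OF \<alpha>(1)] in auto)
  have K_le: "K_const ?F \<le> (1 + x) powr (- 2 * \<alpha>)" if x: "0 < x" "x < 1" for x
  proof -
    have xD: "complex_of_real (- x) \<in> unit_disk"
      using x by simp
    have ge: "?m \<le> Re (quot_id (f_extremal \<alpha>) z)" if "z \<in> unit_disk" for z
      using starlike_class_Re_ge[OF f_extremal_in_starlike_class \<alpha> that] \<alpha> by simp
    \<comment> \<open>\<open>inner\<close> also supplies the lower bound without which a real
      infimum need not lie below its members.\<close>
    have "K_const ?F \<le> (INF z\<in>unit_disk. Re (quot_id (f_extremal \<alpha>) z))"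
      unfolding K_const_def
      by (rule cINF_lower) (use inner f_extremal_in_starlike_class[OF \<alpha>(1)] in \<open>auto intro!: bdd_belowI2\<close>)
    also have "\<dots> \<le> Re (quot_id (f_extremal \<alpha>) (of_real (- x)))"
      by (rule cINF_lower[OF bdd_belowI2[OF ge] xD])
    also have "\<dots> = (1 + x) powr (- 2 * \<alpha>)"
      unfolding quot_id_f_extremal[OF xD] by (subst power_kernel_of_real) (use x in auto)
    finally show ?thesis .
  qed
  have "((\<lambda>x. (1 + x) powr (- 2 * \<alpha>)) \<longlongrightarrow> (1 + 1) powr (- 2 * \<alpha>)) (at_left (1::real))"
    by (intro tendsto_intros) auto
  moreover have "eventually (\<lambda>x. K_const ?F \<le> (1 + x) powr (- 2 * \<alpha>)) (at_left (1::real))"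
    using eventually_at_left_real[of 0 1] by (rule eventually_mono) (use K_le in auto)
  ultimately have "K_const ?F \<le> (1 + 1) powr (- 2 * \<alpha>)"
    by (rule tendsto_lowerbound) simp
  then show "K_const ?F \<le> ?m"
    by (simp add: powr_minus_divide)
qed

text \<open>The witnesses are \<open>z = 1 - cos t e\<^sup>i\<^sup>t\<close>, which run along the circle with diameter \<open>[0, 1]\<close>
  and tend to 1 as \<open>t\<close> tends to \<open>\<pi>/2\<close>.\<close>

lemma B_const_starlike_class:
  assumes \<alpha>: "0 \<le> \<alpha>" "\<alpha> \<le> 1 / 2"
  shows "B_const (starlike_class (1 - \<alpha>)) = 2 * \<alpha>"
proof -
  let ?F = "starlike_class (1 - \<alpha>)"
  define S where "S = (SUP f\<in>?F. SUP z\<in>unit_disk. \<bar>Arg (quot_id f z)\<bar>)"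
  have inner: "(SUP z\<in>unit_disk. \<bar>Arg (quot_id f z)\<bar>) \<le> \<alpha> * pi" if "f \<in> ?F" for f
    by (rule cSUP_least) (use starlike_class_Arg_le[OF that \<alpha>] in auto)
  have S_ge: "2 * \<alpha> * t \<le> S" if t: "0 < t" "t < pi / 2" for t
  proof -
    define z where "z = 1 - of_real (cos t) * cis t"
    have cos: "0 < cos t"
      using t by (intro cos_gt_zero_pi) auto
    have "(norm z)\<^sup>2 = (1 - (cos t)\<^sup>2)\<^sup>2 + (cos t)\<^sup>2 * (sin t)\<^sup>2"
      unfolding cmod_power2 by (simp add: z_def power2_eq_square)
    also have "\<dots> = 1 - (cos t)\<^sup>2"
      unfolding sin_squared_eq by (simp add: power2_eq_square algebra_simps)
    also have "\<dots> < 1"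
      using cos by simp
    finally have zD: "z \<in> unit_disk"
      by (simp add: abs_square_less_1)
    have le: "\<bar>Arg (quot_id (f_extremal \<alpha>) y)\<bar> \<le> \<alpha> * pi" if "y \<in> unit_disk" for y
      using starlike_class_Arg_le[OF f_extremal_in_starlike_class \<alpha> that] \<alpha> by simp
    \<comment> \<open>Here \<open>1 - z\<close> is a positive multiple of
      \<open>cis t\<close>.\<close>
    have "Arg (1 - z) = t"
      using cos t by (simp add: z_def Arg_cis)
    then have "2 * \<alpha> * t = \<bar>Arg (quot_id (f_extremal \<alpha>) z)\<bar>"
      using Arg_power_kernel(1)[OF zD \<alpha>] t by (simp add: quot_id_f_extremal[OF zD])
    also have "\<dots> \<le> (SUP z\<in>unit_disk. \<bar>Arg (quot_id (f_extremal \<alpha>) z)\<bar>)"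
      by (rule cSUP_upper[OF zD bdd_aboveI2[OF le]])
    also have "\<dots> \<le> S"
      unfolding S_def
      by (rule cSUP_upper) (use inner f_extremal_in_starlike_class[OF \<alpha>(1)] in \<open>auto intro!: bdd_aboveI2\<close>)
    finally show ?thesis .
  qed
  have "((\<lambda>t. 2 * \<alpha> * t) \<longlongrightarrow> 2 * \<alpha> * (pi / 2)) (at_left (pi / 2))"
    by (intro tendsto_intros)
  moreover have "eventually (\<lambda>t. 2 * \<alpha> * t \<le> S) (at_left (pi / 2))"
    using eventually_at_left_real[of 0 "pi / 2"] by (rule eventually_mono) (use S_ge in auto)
  ultimately have "2 * \<alpha> * (pi / 2) \<le> S"
    by (rule tendsto_upperbound) simp
  moreover have "S \<le> \<alpha> * pi"
    unfolding S_def
    by (rule cSUP_least) (use inner f_extremal_in_starlike_class[OF \<alpha>(1)] in auto)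
  ultimately have "S = \<alpha> * pi"
    by simp
  then show ?thesis
    by (simp add: B_const_def flip: S_def)
qed

theorem theorem5p1:
  shows "strict_filtration {0..1/2} (\<lambda>\<alpha>. starlike_class (1 - \<alpha>))
    \<and> (\<forall>\<alpha>\<in>{0<..1/2}.
          f_extremal \<alpha> \<in> filtration_boundary {0..1/2} (\<lambda>\<alpha>. starlike_class (1 - \<alpha>)) \<alpha>)
    \<and> (\<forall>\<alpha>\<in>{0<..1/2}. totally_extremal (starlike_class (1 - \<alpha>)) (f_extremal \<alpha>))
    \<and> (\<forall>\<alpha>\<in>{0..1/2}. K_const (starlike_class (1 - \<alpha>)) = 1 / 2 powr (2 * \<alpha>)
          \<and> B_const (starlike_class (1 - \<alpha>)) = 2 * \<alpha>)"
  using strict_filtration_starlike_class f_extremal_boundary totally_extremal_f_extremal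
    K_const_starlike_class B_const_starlike_class by auto

end
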